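(* Let $n \ge 2$ be an integer. For any nonempty polytope $P \subset \mathbb{R}^n$, there exists a finite $n$-player game $G$ whose set of correlated equilibrium payoffs is $P$, i.e. $CEP(G) = P$ (respectively, there exists a finite $n$-player game $G$ such that the convex hull of its set of Nash equilibrium payoffs is $P$, i.e. $Conv(NEP(G)) = P$).
   Context: A polytope in $\mathbb{R}^n$ is the convex hull of a finite set of points. A (finite) $n$-player game $G$ consists of a nonempty finite pure strategy set $S_i$ and a payoff function $u_i : S := S_1 \times \cdots \times S_n \to \mathbb{R}$ for each player $i \in \{1,\dots,n\}$. Write $S_{-i} := \prod_{j \ne i} S_j$. A correlated equilibrium of $G$ is a probability distribution $\mu$ on $S$ such that for every player $i$ and all $s_i, t_i \in S_i$, $\sum_{s_{-i} \in S_{-i}} \mu(s_i,s_{-i})\,[u_i(s_i,s_{-i}) - u_i(t_i,s_{-i})] \ge 0$. For a probability distribution $\mu$ on $S$, $u_i(\mu) := \sum_{s \in S} \mu(s) u_i(s)$. $CEP(G) \subset \mathbb{R}^n$ denotes the set of all vectors $(u_1(\mu),\dots,u_n(\mu))$ where $\mu$ is a correlated equilibrium of $G$. $NEP(G) \subset \mathbb{R}^n$ denotes the set of all vectors of expected payoffs of (mixed) Nash equilibria of $G$. $Conv(A)$ denotes the convex hull of $A \subset \mathbb{R}^n$. *)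

theory Defs
  imports "HOL-Probability.Probability"
begin

(* Players are the elements of the finite type 'n, so payoff vectors live in real^'n.  Only the
   values of the payoff functions on pure strategy profiles matter. *)
record ('n, 'a) game =
  strategies :: "'n \<Rightarrow> 'a set"
  utility :: "'n \<Rightarrow> ('n \<Rightarrow> 'a) \<Rightarrow> real"

definition finite_game :: "('n::finite, 'a) game \<Rightarrow> bool" where
  "finite_game G \<longleftrightarrow> (\<forall>i. finite (strategies G i) \<and> strategies G i \<noteq> {})"

definition profiles :: "('n::finite, 'a) game \<Rightarrow> ('n \<Rightarrow> 'a) set" where
  "profiles G = PiE UNIV (strategies G)"

definition other_profiles :: "('n::finite, 'a) game \<Rightarrow> 'n \<Rightarrow> ('n \<Rightarrow> 'a) set" where
  "other_profiles G i = PiE (UNIV - {i}) (strategies G)"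

definition expected_payoff :: "('n::finite, 'a) game \<Rightarrow> ('n \<Rightarrow> 'a) pmf \<Rightarrow> 'n \<Rightarrow> real" where
  "expected_payoff G \<mu> i = (\<Sum>s\<in>profiles G. pmf \<mu> s * utility G i s)"

(* For r in other_profiles G i, the full profile (a, r) is r(i := a). *)
definition correlated_equilibrium :: "('n::finite, 'a) game \<Rightarrow> ('n \<Rightarrow> 'a) pmf \<Rightarrow> bool" where
  "correlated_equilibrium G \<mu> \<longleftrightarrow>
     set_pmf \<mu> \<subseteq> profiles G \<and>
     (\<forall>i. \<forall>a\<in>strategies G i. \<forall>b\<in>strategies G i.
        (\<Sum>r\<in>other_profiles G i.
           pmf \<mu> (r(i := a)) * (utility G i (r(i := a)) - utility G i (r(i := b)))) \<ge> 0)"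

(* Independent randomization.  The default value of Pi_pmf is irrelevant here, since the index
   set is UNIV. *)
definition mixed_distribution :: "('n::finite \<Rightarrow> 'a pmf) \<Rightarrow> ('n \<Rightarrow> 'a) pmf" where
  "mixed_distribution \<sigma> = Pi_pmf UNIV undefined \<sigma>"

definition nash_equilibrium :: "('n::finite, 'a) game \<Rightarrow> ('n \<Rightarrow> 'a pmf) \<Rightarrow> bool" where
  "nash_equilibrium G \<sigma> \<longleftrightarrow>
     (\<forall>i. set_pmf (\<sigma> i) \<subseteq> strategies G i) \<and>
     (\<forall>i \<tau>. set_pmf \<tau> \<subseteq> strategies G i \<longrightarrow>
        expected_payoff G (mixed_distribution (\<sigma>(i := \<tau>))) i
          \<le> expected_payoff G (mixed_distribution \<sigma>) i)"

definition CEP :: "('n::finite, 'a) game \<Rightarrow> (real ^ 'n) set" where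
  "CEP G = {(\<chi> i. expected_payoff G \<mu> i) | \<mu>. correlated_equilibrium G \<mu>}"

definition NEP :: "('n::finite, 'a) game \<Rightarrow> (real ^ 'n) set" where
  "NEP G = {(\<chi> i. expected_payoff G (mixed_distribution \<sigma>) i) | \<sigma>. nash_equilibrium G \<sigma>}"

end

(* Player i's payoff is vertex number s (partner i) of P, where partner i is some other player,
   minus a penalty when some player names a smaller number than i does.  The first part is beyond
   the control of player i, so it does not affect incentives.  Naming 0 always avoids the penalty,
   so a correlated equilibrium charges only profiles in which nobody is penalized, that is, in
   which everyone names the same vertex; conversely, each distribution on such profiles is an
   equilibrium.  The unanimous profiles are moreover pure Nash equilibria, and Nash equilibria are
   correlated equilibria, so the same game proves both claims. *)

theory Submission
  imports Defs
begin

section \<open>Expected payoffs and Nash equilibria\<close>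

lemma finite_profiles: "finite_game G \<Longrightarrow> finite (profiles G)"
  unfolding finite_game_def profiles_def by (intro finite_PiE) auto

lemma finite_other_profiles: "finite_game G \<Longrightarrow> finite (other_profiles G i)"
  unfolding finite_game_def other_profiles_def by (intro finite_PiE) auto

lemma update_in_profiles:
  "r \<in> other_profiles G i \<Longrightarrow> a \<in> strategies G i \<Longrightarrow> r(i := a) \<in> profiles G"
  unfolding profiles_def other_profiles_def by (auto simp: PiE_def Pi_def)

lemma drop_in_other_profiles:
  "s \<in> profiles G \<Longrightarrow> s(i := undefined) \<in> other_profiles G i"
  unfolding profiles_def other_profiles_def by (auto simp: PiE_def Pi_def)

text \<open>A profile is recovered from its \<open>i\<close>-th entry and its copy with that entry
  reset to \<open>undefined\<close>, the default value outside the domain of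
  \<open>other_profiles G i\<close>. This links expected payoffs to the sums in the correlated
  equilibrium condition.\<close>

lemma sum_profiles_split:
  fixes h :: "('n::finite \<Rightarrow> 'a) \<Rightarrow> real"
  shows "(\<Sum>s\<in>profiles G. h s) =
    (\<Sum>a\<in>strategies G i. \<Sum>r\<in>other_profiles G i. h (r(i := a)))"
proof -
  have "(\<Sum>s\<in>profiles G. h s) =
    (\<Sum>(a, r)\<in>strategies G i \<times> other_profiles G i. h (r(i := a)))"
  proof (rule sum.reindex_bij_witness[where i = "\<lambda>(a, r). r(i := a)"
        and j = "\<lambda>s. (s i, s(i := undefined))"])
    fix p assume "p \<in> strategies G i \<times> other_profiles G i"
    then show "(case p of (a, r) \<Rightarrow> r(i := a)) \<in> profiles G"
      "((case p of (a, r) \<Rightarrow> r(i := a)) i,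
        (case p of (a, r) \<Rightarrow> r(i := a))(i := undefined)) = p"
      by (auto simp: update_in_profiles)
        (auto simp: other_profiles_def PiE_def extensional_def)
  next
    fix s assume s: "s \<in> profiles G"
    then show "(s i, s(i := undefined)) \<in> strategies G i \<times> other_profiles G i"
      using drop_in_other_profiles[OF s] by (auto simp: profiles_def)
  qed auto
  then show ?thesis
    by (simp add: sum.cartesian_product)
qed

lemma expected_payoff_le:
  assumes fin: "finite_game G" and sub: "set_pmf \<mu> \<subseteq> profiles G"
    and le: "\<And>s. s \<in> set_pmf \<mu> \<Longrightarrow> utility G i s \<le> c"
  shows "expected_payoff G \<mu> i \<le> c"
proof -
  have "expected_payoff G \<mu> i \<le> (\<Sum>s\<in>profiles G. pmf \<mu> s * c)"
    unfolding expected_payoff_def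
  proof (rule sum_mono)
    fix s
    show "pmf \<mu> s * utility G i s \<le> pmf \<mu> s * c"
      using le[of s] by (cases "s \<in> set_pmf \<mu>") (auto simp: set_pmf_iff mult_left_mono)
  qed
  also have "\<dots> = c"
    using sum_pmf_eq_1[OF finite_profiles[OF fin] sub] by (simp add: sum_distrib_right[symmetric])
  finally show ?thesis .
qed

lemma set_mixed_distribution:
  "set_pmf (mixed_distribution \<sigma>) = {s. \<forall>i. s i \<in> set_pmf (\<sigma> i)}"
  unfolding mixed_distribution_def by (auto simp: set_Pi_pmf PiE_dflt_def)

lemma mixed_distribution_profiles:
  "(\<And>i. set_pmf (\<sigma> i) \<subseteq> strategies G i) \<Longrightarrow> set_pmf (mixed_distribution \<sigma>) \<subseteq> profiles G"
  unfolding set_mixed_distribution profiles_def by (auto simp: PiE_def)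

text \<open>By independence, the factor of the opponents does not depend on
  \<open>\<sigma> i\<close>, so the payoff of player \<open>i\<close> is linear in the player's own
  mixed strategy.\<close>

lemma pmf_mixed_distribution_update:
  "pmf (mixed_distribution \<sigma>) (r(i := a)) = pmf (\<sigma> i) a * (\<Prod>j\<in>UNIV - {i}. pmf (\<sigma> j) (r j))"
proof -
  have "pmf (mixed_distribution \<sigma>) (r(i := a)) = (\<Prod>j\<in>UNIV. pmf (\<sigma> j) ((r(i := a)) j))"
    unfolding mixed_distribution_def by (subst pmf_Pi) auto
  also have "\<dots> = pmf (\<sigma> i) a * (\<Prod>j\<in>UNIV - {i}. pmf (\<sigma> j) ((r(i := a)) j))"
    by (subst prod.remove[of _ i]) auto
  also have "(\<Prod>j\<in>UNIV - {i}. pmf (\<sigma> j) ((r(i := a)) j)) = (\<Prod>j\<in>UNIV - {i}. pmf (\<sigma> j) (r j))"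
    by (rule prod.cong) auto
  finally show ?thesis .
qed

text \<open>The incentive sum for \<open>a\<close> against \<open>b\<close> factors as the
  probability of \<open>a\<close> times the gain of \<open>a\<close> over \<open>b\<close> against
  the opponents' mixture. In a Nash equilibrium every pure strategy of positive probability is a
  best reply, so this product is nonnegative.\<close>

lemma nash_imp_correlated:
  assumes fin: "finite_game G" and nash: "nash_equilibrium G \<sigma>"
  shows "correlated_equilibrium G (mixed_distribution \<sigma>)"
  unfolding correlated_equilibrium_def
proof (intro conjI allI ballI)
  have sub: "set_pmf (\<sigma> i) \<subseteq> strategies G i" for i
    using nash by (auto simp: nash_equilibrium_def)
  then show "set_pmf (mixed_distribution \<sigma>) \<subseteq> profiles G"
    by (rule mixed_distribution_profiles)
  fix i a b assume a: "a \<in> strategies G i" and b: "b \<in> strategies G i"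
  \<comment> \<open>\<open>q r\<close> is the probability that the opponents play \<open>r\<close>,
    and \<open>W x\<close> is the payoff of player \<open>i\<close> from the pure strategy
    \<open>x\<close> against them.\<close>
  define q where "q r = (\<Prod>j\<in>UNIV - {i}. pmf (\<sigma> j) (r j))" for r
  define W where "W x = (\<Sum>r\<in>other_profiles G i. q r * utility G i (r(i := x)))" for x
  have finS: "finite (strategies G i)"
    using fin by (simp add: finite_game_def)
  have payoff: "expected_payoff G (mixed_distribution (\<sigma>(i := \<tau>))) i =
      (\<Sum>x\<in>strategies G i. pmf \<tau> x * W x)" for \<tau>
  proof -
    have "(\<Prod>j\<in>UNIV - {i}. pmf ((\<sigma>(i := \<tau>)) j) (r j)) = q r" for r
      unfolding q_def by (rule prod.cong) auto
    then show ?thesis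
      unfolding expected_payoff_def sum_profiles_split[where i = i] pmf_mixed_distribution_update
        W_def sum_distrib_left by (simp add: mult.assoc)
  qed
  define M where "M = (\<Sum>x\<in>strategies G i. pmf (\<sigma> i) x * W x)"
  have W_le: "W x \<le> M" if x: "x \<in> strategies G i" for x
  proof -
    \<comment> \<open>The trivial update \<open>\<sigma>(i := \<sigma> i)\<close> brings both sides
      into the form of \<open>payoff\<close>.\<close>
    have "expected_payoff G (mixed_distribution (\<sigma>(i := return_pmf x))) i
        \<le> expected_payoff G (mixed_distribution (\<sigma>(i := \<sigma> i))) i"
      using nash x by (auto simp: nash_equilibrium_def)
    moreover have "(\<Sum>y\<in>strategies G i. pmf (return_pmf x) y * W y) = W x"
    proof -
      have "(\<Sum>y\<in>strategies G i. pmf (return_pmf x) y * W y) =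
          (\<Sum>y\<in>strategies G i. if y = x then W y else 0)"
        by (rule sum.cong) auto
      then show ?thesis
        using finS x by simp
    qed
    ultimately show ?thesis
      unfolding payoff M_def by simp
  qed
  \<comment> \<open>\<open>M\<close> is the average of the \<open>W x\<close> and also an upper
    bound for them, so each weighted gap vanishes: either \<open>a\<close> has probability 0 or
    \<open>W a = M\<close>.\<close>
  have "(\<Sum>x\<in>strategies G i. pmf (\<sigma> i) x * (M - W x)) = 0"
    using sum_pmf_eq_1[OF finS sub]
    by (simp add: right_diff_distrib sum_subtractf sum_distrib_right[symmetric] M_def)
  then have "pmf (\<sigma> i) a * (M - W a) = 0"
    using a W_le finS by (subst (asm) sum_nonneg_eq_0_iff) auto
  then have "pmf (\<sigma> i) a * (W a - W b) \<ge> 0"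
    using W_le[OF b] by auto
  also have "pmf (\<sigma> i) a * (W a - W b) = (\<Sum>r\<in>other_profiles G i.
      pmf (mixed_distribution \<sigma>) (r(i := a)) *
      (utility G i (r(i := a)) - utility G i (r(i := b))))"
    unfolding pmf_mixed_distribution_update W_def q_def
    by (simp add: sum_subtractf[symmetric] sum_distrib_left algebra_simps)
  finally show "0 \<le> (\<Sum>r\<in>other_profiles G i.
      pmf (mixed_distribution \<sigma>) (r(i := a)) *
      (utility G i (r(i := a)) - utility G i (r(i := b))))" .
qed

corollary NEP_subset_CEP: "finite_game G \<Longrightarrow> NEP G \<subseteq> CEP G"
  unfolding NEP_def CEP_def using nash_imp_correlated by blast

section \<open>The vertex-naming game\<close>

definition naming_game ::
  "nat \<Rightarrow> (nat \<Rightarrow> real ^ 'n) \<Rightarrow> ('n::finite \<Rightarrow> 'n) \<Rightarrow> ('n, nat) game" where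
  "naming_game m v partner =
    \<lparr>strategies = (\<lambda>_. {..<m}),
     utility = (\<lambda>i s. v (s (partner i)) $ i - (if \<exists>j. s j < s i then 1 else 0))\<rparr>"

lemma strategies_naming_game [simp]: "strategies (naming_game m v partner) i = {..<m}"
  and utility_naming_game [simp]: "utility (naming_game m v partner) i s =
    v (s (partner i)) $ i - (if \<exists>j. s j < s i then 1 else 0)"
  by (simp_all add: naming_game_def)

lemma profiles_naming_game: "profiles (naming_game m v partner) = {s. \<forall>i. s i < m}"
  by (auto simp: profiles_def PiE_def Pi_def)

lemma finite_naming_game: "0 < m \<Longrightarrow> finite_game (naming_game m v partner)"
  by (auto simp: finite_game_def)

section \<open>Correlated equilibria of the naming game and their payoffs\<close>

lemma naming_game_equilibrium_unanimous:
  fixes v :: "nat \<Rightarrow> real ^ 'n::finite"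
  assumes m: "0 < m" and partner: "\<And>i. partner i \<noteq> i"
    and ce: "correlated_equilibrium (naming_game m v partner) \<mu>" and s: "s \<in> set_pmf \<mu>"
  shows "s i \<le> s j"
proof (rule ccontr)
  assume "\<not> s i \<le> s j"
  then have less: "s j < s i" by simp
  let ?G = "naming_game m v partner"
  \<comment> \<open>The summands of the incentive constraint for the deviation from
    \<open>s i\<close> to 0. The \<open>v\<close> terms cancel because \<open>partner i\<close>
    differs from \<open>i\<close>, leaving minus the penalty for naming \<open>s i\<close>.\<close>
  define g where "g r = pmf \<mu> (r(i := s i)) *
    (utility ?G i (r(i := s i)) - utility ?G i (r(i := 0)))" for r
  have sG: "s \<in> profiles ?G"
    using ce s by (auto simp: correlated_equilibrium_def)
  have g_le: "g r \<le> 0" for r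
    using partner by (auto simp: g_def)
  have "0 \<le> (\<Sum>r\<in>other_profiles ?G i. g r)"
  proof -
    have "s i \<in> strategies ?G i" "0 \<in> strategies ?G i"
      using sG m by (auto simp: profiles_naming_game)
    then show ?thesis
      using ce unfolding correlated_equilibrium_def g_def by blast
  qed
  then have "(\<Sum>r\<in>other_profiles ?G i. - g r) = 0"
    using sum_nonpos[of "other_profiles ?G i" g] g_le by (simp add: sum_negf)
  \<comment> \<open>A sum of nonpositive terms that is nonnegative has only zero terms. The term
    chosen here belongs to \<open>s\<close> itself, where \<open>s j < s i\<close> incurs the
    penalty.\<close>
  then have "g (s(i := undefined)) = 0"
    using g_le finite_other_profiles[OF finite_naming_game[OF m, of v partner], of i]
      drop_in_other_profiles[OF sG, of i]
    by (subst (asm) sum_nonneg_eq_0_iff) auto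
  moreover have "g (s(i := undefined)) = - pmf \<mu> s"
    using less partner by (auto simp: g_def)
  ultimately show False
    using s by (simp add: set_pmf_iff)
qed

text \<open>For the converse, every incentive summand is nonnegative: off the support it is 0, and
  at a unanimous profile a deviation leaves the \<open>v\<close> term unchanged and can only add a
  penalty.\<close>

lemma naming_game_correlated_iff:
  fixes v :: "nat \<Rightarrow> real ^ 'n::finite"
  assumes m: "0 < m" and partner: "\<And>i. partner i \<noteq> i"
  shows "correlated_equilibrium (naming_game m v partner) \<mu> \<longleftrightarrow>
    set_pmf \<mu> \<subseteq> (\<lambda>k _. k) ` {..<m}"
proof
  assume ce: "correlated_equilibrium (naming_game m v partner) \<mu>"
  show "set_pmf \<mu> \<subseteq> (\<lambda>k _. k) ` {..<m}"
  proof
    fix s assume s: "s \<in> set_pmf \<mu>"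
    have "s i = s j" for i j
      using naming_game_equilibrium_unanimous[OF m partner ce s] by (meson antisym)
    \<comment> \<open>Here \<open>undefined\<close> serves as an arbitrary player whose number
      represents the common one.\<close>
    then have "s = (\<lambda>_. s undefined)" by blast
    moreover have "s undefined < m"
      using ce s by (auto simp: correlated_equilibrium_def profiles_naming_game)
    ultimately show "s \<in> (\<lambda>k _. k) ` {..<m}" by blast
  qed
next
  assume sub: "set_pmf \<mu> \<subseteq> (\<lambda>k _. k) ` {..<m}"
  show "correlated_equilibrium (naming_game m v partner) \<mu>"
    unfolding correlated_equilibrium_def
  proof (intro conjI allI ballI)
    show "set_pmf \<mu> \<subseteq> profiles (naming_game m v partner)"
      using sub by (auto simp: profiles_naming_game)
    fix i a b
    show "0 \<le> (\<Sum>r\<in>other_profiles (naming_game m v partner) i. pmf \<mu> (r(i := a)) *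
      (utility (naming_game m v partner) i (r(i := a)) -
       utility (naming_game m v partner) i (r(i := b))))"
    proof (rule sum_nonneg)
      fix r
      show "0 \<le> pmf \<mu> (r(i := a)) * (utility (naming_game m v partner) i (r(i := a)) -
        utility (naming_game m v partner) i (r(i := b)))"
      proof (cases "r(i := a) \<in> set_pmf \<mu>")
        case True
        then obtain k where "r(i := a) = (\<lambda>_. k)" using sub by blast
        then have "(r(i := a)) j = k" for j by simp
        then have "\<not> (\<exists>j. (r(i := a)) j < (r(i := a)) i)" by (metis less_irrefl)
        then show ?thesis
          using partner[of i] by (simp only: utility_naming_game) auto
      qed (simp add: set_pmf_iff)
    qed
  qed
qed

lemma naming_game_payoff_unanimous:
  fixes v :: "nat \<Rightarrow> real ^ 'n::finite"
  assumes "set_pmf \<mu> \<subseteq> (\<lambda>k _. k) ` {..<m}"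
  shows "expected_payoff (naming_game m v partner) \<mu> i = (\<Sum>k<m. pmf \<mu> (\<lambda>_. k) * v k $ i)"
proof -
  have "expected_payoff (naming_game m v partner) \<mu> i =
      (\<Sum>s\<in>(\<lambda>k _. k) ` {..<m}. pmf \<mu> s * utility (naming_game m v partner) i s)"
    unfolding expected_payoff_def
  proof (rule sum.mono_neutral_right)
    show "finite (profiles (naming_game m v partner))"
      unfolding profiles_def by (intro finite_PiE) auto
    show "\<forall>s\<in>profiles (naming_game m v partner) - (\<lambda>k _. k) ` {..<m}.
        pmf \<mu> s * utility (naming_game m v partner) i s = 0"
      using assms by (metis DiffD2 mult_zero_left set_pmf_iff subsetD)
  qed (auto simp: profiles_naming_game)
  also have "\<dots> = (\<Sum>k<m. pmf \<mu> (\<lambda>_. k) * v k $ i)"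
    by (subst sum.reindex) (auto simp: inj_on_def fun_eq_iff)
  finally show ?thesis .
qed

section \<open>Convex weights as probability distributions\<close>

lemma exists_pmf_with_weights:
  fixes c :: "nat \<Rightarrow> real"
  assumes "\<And>k. k < m \<Longrightarrow> 0 \<le> c k" and "(\<Sum>k<m. c k) = 1"
  shows "\<exists>p. set_pmf p \<subseteq> {..<m} \<and> (\<forall>k<m. pmf p k = c k)"
proof -
  \<comment> \<open>The weights are cut off to 0 from \<open>m\<close> on, since
    \<open>embed_pmf\<close> takes a density on all of \<open>nat\<close>.\<close>
  define d where "d k = (if k < m then c k else 0)" for k
  have nonneg: "0 \<le> d k" for k
    using assms(1) by (simp add: d_def)
  have "(\<integral>\<^sup>+k. ennreal (d k) \<partial>count_space UNIV) = (\<Sum>k<m. ennreal (d k))"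
    by (rule nn_integral_count_space') (auto simp: d_def)
  also have "\<dots> = 1"
    using assms nonneg by (subst sum_ennreal) (auto simp: d_def)
  finally have "pmf (embed_pmf d) k = d k" for k
    using nonneg by (subst pmf_embed_pmf) auto
  then show ?thesis
    by (intro exI[of _ "embed_pmf d"]) (auto simp: set_pmf_iff d_def split: if_splits)
qed

lemma convex_hull_image_weights:
  fixes f :: "'b \<Rightarrow> 'c::real_vector"
  assumes I: "finite I" and x: "x \<in> convex hull (f ` I)"
  shows "\<exists>c. (\<forall>i\<in>I. 0 \<le> c i) \<and> sum c I = 1 \<and> x = (\<Sum>i\<in>I. c i *\<^sub>R f i)"
proof -
  obtain J where J: "J \<subseteq> I" "inj_on f J" "f ` I = f ` J"
    using subset_image_inj[of "f ` I" f I] by auto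
  have "finite J"
    using J(1) I finite_subset by blast
  then obtain u where u: "\<forall>y\<in>f ` J. 0 \<le> u y" "sum u (f ` J) = 1"
      "(\<Sum>y\<in>f ` J. u y *\<^sub>R y) = x"
    using x J(3) by (auto simp: convex_hull_finite)
  define c where "c i = (if i \<in> J then u (f i) else 0)" for i
  have "sum c I = (\<Sum>i\<in>J. u (f i))"
    using I J(1) by (intro sum.mono_neutral_cong_right) (auto simp: c_def)
  moreover have "(\<Sum>i\<in>I. c i *\<^sub>R f i) = (\<Sum>i\<in>J. u (f i) *\<^sub>R f i)"
    using I J(1) by (intro sum.mono_neutral_cong_right) (auto simp: c_def)
  ultimately show ?thesis
    using u J(2) by (intro exI[of _ c]) (auto simp: sum.reindex c_def)
qed

text \<open>Distributions on unanimous profiles amount to convex weights on \<open>{..<m}\<close>,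
  and the payoff vector is the convex combination of the \<open>v k\<close> with these
  weights.\<close>

lemma CEP_naming_game:
  fixes v :: "nat \<Rightarrow> real ^ 'n::finite"
  assumes m: "0 < m" and partner: "\<And>i. partner i \<noteq> i"
  shows "CEP (naming_game m v partner) = convex hull (v ` {..<m})"
proof
  show "CEP (naming_game m v partner) \<subseteq> convex hull (v ` {..<m})"
  proof
    fix x assume "x \<in> CEP (naming_game m v partner)"
    then obtain \<mu> where ce: "correlated_equilibrium (naming_game m v partner) \<mu>"
      and x: "x = (\<chi> i. expected_payoff (naming_game m v partner) \<mu> i)"
      by (auto simp: CEP_def)
    have sub: "set_pmf \<mu> \<subseteq> (\<lambda>k (_::'n). k) ` {..<m}"
      using ce naming_game_correlated_iff[OF m partner] by blast
    have "(\<Sum>k<m. pmf \<mu> (\<lambda>_. k)) = (\<Sum>s\<in>(\<lambda>k _. k) ` {..<m}. pmf \<mu> s)"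
      by (subst sum.reindex) (auto simp: inj_on_def fun_eq_iff)
    also have "\<dots> = 1"
      by (rule sum_pmf_eq_1) (use sub in auto)
    finally have "(\<Sum>k<m. pmf \<mu> (\<lambda>_. k) *\<^sub>R v k) \<in> convex hull (v ` {..<m})"
      by (intro convex_sum) (auto intro: hull_inc)
    also have "(\<Sum>k<m. pmf \<mu> (\<lambda>_. k) *\<^sub>R v k) = x"
      unfolding x vec_eq_iff by (simp add: naming_game_payoff_unanimous[OF sub])
    finally show "x \<in> convex hull (v ` {..<m})" .
  qed
next
  show "convex hull (v ` {..<m}) \<subseteq> CEP (naming_game m v partner)"
  proof
    fix x assume "x \<in> convex hull (v ` {..<m})"
    then obtain c where c: "\<And>k. k < m \<Longrightarrow> 0 \<le> c k" "(\<Sum>k<m. c k) = 1"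
      and x: "x = (\<Sum>k<m. c k *\<^sub>R v k)"
      using convex_hull_image_weights[of "{..<m}" x v] by auto
    obtain p where p: "set_pmf p \<subseteq> {..<m}" "\<forall>k<m. pmf p k = c k"
      using exists_pmf_with_weights[OF c] by blast
    \<comment> \<open>All players are told the same number drawn from \<open>p\<close>. The diagonal
      map is injective, so the weights survive.\<close>
    let ?\<mu> = "map_pmf (\<lambda>k (_::'n). k) p"
    have sub: "set_pmf ?\<mu> \<subseteq> (\<lambda>k (_::'n). k) ` {..<m}"
      using p(1) by auto
    have "pmf ?\<mu> (\<lambda>_. k) = pmf p k" for k
      by (rule pmf_map_inj') (auto simp: inj_def fun_eq_iff)
    then have "x = (\<chi> i. expected_payoff (naming_game m v partner) ?\<mu> i)"
      unfolding x vec_eq_iff by (simp add: naming_game_payoff_unanimous[OF sub] p(2))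
    then show "x \<in> CEP (naming_game m v partner)"
      using naming_game_correlated_iff[OF m partner] sub unfolding CEP_def by blast
  qed
qed

text \<open>When everyone names \<open>k\<close> and player \<open>i\<close> deviates, the partner
  still names \<open>k\<close>, so the deviator gets at most \<open>v k $ i\<close>, which is the
  payoff without a deviation.\<close>

lemma vertices_in_NEP_naming_game:
  fixes v :: "nat \<Rightarrow> real ^ 'n::finite"
  assumes m: "0 < m" and partner: "\<And>i. partner i \<noteq> i" and k: "k < m"
  shows "v k \<in> NEP (naming_game m v partner)"
proof -
  let ?G = "naming_game m v partner"
  let ?\<sigma> = "\<lambda>_::'n. return_pmf k"
  have mixed: "mixed_distribution ?\<sigma> = return_pmf (\<lambda>_. k)"
    unfolding mixed_distribution_def by (subst Pi_pmf_return_pmf) auto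
  have payoff: "expected_payoff ?G (mixed_distribution ?\<sigma>) i = v k $ i" for i
  proof -
    have "expected_payoff ?G (mixed_distribution ?\<sigma>) i =
        (\<Sum>l<m. if l = k then v l $ i else 0)"
      unfolding mixed using k
      by (subst naming_game_payoff_unanimous) (auto simp: fun_eq_iff indicator_def intro: sum.cong)
    then show ?thesis
      using k by simp
  qed
  have "nash_equilibrium ?G ?\<sigma>"
    unfolding nash_equilibrium_def
  proof (intro conjI allI impI)
    fix i \<tau> assume \<tau>: "set_pmf \<tau> \<subseteq> strategies ?G i"
    show "expected_payoff ?G (mixed_distribution (?\<sigma>(i := \<tau>))) i
        \<le> expected_payoff ?G (mixed_distribution ?\<sigma>) i"
      unfolding payoff
    proof (rule expected_payoff_le[OF finite_naming_game[OF m]])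
      show "set_pmf (mixed_distribution (?\<sigma>(i := \<tau>))) \<subseteq> profiles ?G"
        using \<tau> k by (intro mixed_distribution_profiles) auto
    next
      fix s assume "s \<in> set_pmf (mixed_distribution (?\<sigma>(i := \<tau>)))"
      then have "s (partner i) \<in> set_pmf ((?\<sigma>(i := \<tau>)) (partner i))"
        by (simp only: set_mixed_distribution mem_Collect_eq)
      then have "s (partner i) = k"
        using partner[of i] by simp
      then show "utility ?G i s \<le> v k $ i" by simp
    qed
  qed (use k in auto)
  moreover have "v k = (\<chi> i. expected_payoff ?G (mixed_distribution ?\<sigma>) i)"
    by (simp add: vec_eq_iff payoff)
  ultimately show ?thesis
    unfolding NEP_def by blast
qed

text \<open>\<open>NEP\<close> lies between the set of the points \<open>v k\<close> and
  \<open>CEP\<close>, which is already the convex hull of these points.\<close>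

lemma convex_hull_NEP_naming_game:
  fixes v :: "nat \<Rightarrow> real ^ 'n::finite"
  assumes m: "0 < m" and partner: "\<And>i. partner i \<noteq> i"
  shows "convex hull (NEP (naming_game m v partner)) = convex hull (v ` {..<m})"
proof
  show "convex hull (NEP (naming_game m v partner)) \<subseteq> convex hull (v ` {..<m})"
    using NEP_subset_CEP[OF finite_naming_game[OF m, of v partner]] CEP_naming_game[OF m partner]
    by (intro hull_minimal) auto
  show "convex hull (v ` {..<m}) \<subseteq> convex hull (NEP (naming_game m v partner))"
    using vertices_in_NEP_naming_game[OF m partner] by (intro hull_mono) auto
qed

theorem proposition1:
  fixes P :: "(real ^ 'n) set"
  assumes "CARD('n) \<ge> 2" and "polytope P" and "P \<noteq> {}"
  shows "(\<exists>G :: ('n, nat) game. finite_game G \<and> CEP G = P) \<and>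
         (\<exists>G :: ('n, nat) game. finite_game G \<and> convex hull (NEP G) = P)"
proof -
  obtain V where V: "finite V" "P = convex hull V"
    using assms(2) by (auto simp: polytope_def)
  obtain v :: "nat \<Rightarrow> real ^ 'n" and m where v: "V = v ` {..<m}"
    using V(1) by (metis finite_imp_nat_seg_image_inj_on lessThan_def)
  \<comment> \<open>For \<open>m = 0\<close> the hull would be empty; nonemptiness of
    \<open>P\<close> thus gives every player a strategy.\<close>
  have m: "0 < m"
    using assms(3) V(2) v by (cases m) auto
  \<comment> \<open>With at least two players, each has another one to serve as partner.\<close>
  have "\<exists>j. j \<noteq> i" for i :: 'n
  proof (rule ccontr)
    assume "\<nexists>j. j \<noteq> i"
    then have "UNIV = {i}" by auto
    then have "CARD('n) = card {i}" by (rule arg_cong)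
    then show False using assms(1) by simp
  qed
  then obtain partner :: "'n \<Rightarrow> 'n" where partner: "\<And>i. partner i \<noteq> i"
    by metis
  show ?thesis
    using finite_naming_game[OF m] CEP_naming_game[OF m partner]
      convex_hull_NEP_naming_game[OF m partner] V(2) v by blast
qed

end
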